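(* Let $\mathcal{A}$ and $\mathcal{B}$ be classes of structures of the same relational vocabulary with $\mathrm{dom}(\mathcal{A})=\mathrm{dom}(\mathcal{B})$, and let $w$ be a positive integer. Then the following conditions are equivalent: (1) Player I has a winning strategy in the game $\mathrm{EF}_w(\mathcal{A},\mathcal{B})$. (2) There is a first order formula $\phi$ of size $\mathrm{w}(\phi)\le w$ such that $(\mathcal{A},\mathcal{B})\models\phi$.
   Context: Vocabularies are relational; models $\mathfrak{A}$ have nonempty universe $A$. Variables are $x_j$, $j\in\mathbb{N}$. A variable assignment for $\mathfrak{A}$ is a finite partial map $\alpha:\mathbb{N}\to A$ with domain $\mathrm{dom}(\alpha)$. A "structure" here is a pair $(\mathfrak{A},\alpha)$ of a model and an assignment. In a class $\mathcal{A}$ of structures all models have the same vocabulary and all assignments have the same domain, denoted $\mathrm{dom}(\mathcal{A})$ (for classes arising in a game that may be empty, the domain is the one carried along by the position). $(\mathfrak{A},\alpha)\models\phi$ means that $\alpha$ satisfies $\phi$ in $\mathfrak{A}$; this requires $j\in\mathrm{dom}(\alpha)$ for every free variable $x_j$ of $\phi$. First order formulas (with equality) are built from atomic formulas by $\neg,\vee,\wedge,\exists x_j,\forall x_j$. $\alpha(a/j)$ is the assignment mapping $j$ to $a$ and agreeing with $\alpha$ otherwise. For a choice function $F$ on $\mathcal{A}$ (i.e. $F((\mathfrak{A},\alpha))\in A$ for all $(\mathfrak{A},\alpha)\in\mathcal{A}$), $\mathcal{A}(F/j)=\{(\mathfrak{A},\alpha(F((\mathfrak{A},\alpha))/j)):(\mathfrak{A},\alpha)\in\mathcal{A}\}$.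 Also $\mathcal{A}(\star/j)=\{(\mathfrak{A},\alpha(a/j)):(\mathfrak{A},\alpha)\in\mathcal{A},\,a\in A\}$. Separation: $(\mathcal{A},\mathcal{B})\models\phi$ means that the indices of free variables of $\phi$ are in $\mathrm{dom}(\mathcal{A})=\mathrm{dom}(\mathcal{B})$, $(\mathfrak{A},\alpha)\models\phi$ for all $(\mathfrak{A},\alpha)\in\mathcal{A}$, and $(\mathfrak{B},\beta)\not\models\phi$ for all $(\mathfrak{B},\beta)\in\mathcal{B}$. Size: $\mathrm{w}(\phi)=1$ for atomic $\phi$, $\mathrm{w}(\neg\phi)=\mathrm{w}(\phi)$, $\mathrm{w}(\phi\vee\psi)=\mathrm{w}(\phi\wedge\psi)=\mathrm{w}(\phi)+\mathrm{w}(\psi)$, $\mathrm{w}(\exists x_j\phi)=\mathrm{w}(\forall x_j\phi)=\mathrm{w}(\phi)+1$. The game $\mathrm{EF}_w(\mathcal{A},\mathcal{B})$ has players I and II; the initial position is $(w,\mathcal{A},\mathcal{B})$. If in position $(w_m,\mathcal{A}_m,\mathcal{B}_m)$ there is an atomic or negated atomic formula $\phi$ with $(\mathcal{A}_m,\mathcal{B}_m)\models\phi$, the game ends and player I wins. Otherwise, if $w_m=1$, the game ends and player II wins. Otherwise player I makes one of the following moves. Left splitting move: player I chooses integers $u,v\ge1$ with $u+v=w_m$ and writes $\mathcal{A}_m=\mathcal{C}\cup\mathcal{D}$ (parts may be empty); player II chooses whether the game continues from $(u,\mathcal{C},\mathcal{B}_m)$ or $(v,\mathcal{D},\mathcal{B}_m)$.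 Right splitting move: player I chooses integers $u,v\ge1$ with $u+v=w_m$ and writes $\mathcal{B}_m=\mathcal{C}\cup\mathcal{D}$; player II chooses whether the game continues from $(u,\mathcal{A}_m,\mathcal{C})$ or $(v,\mathcal{A}_m,\mathcal{D})$. Left supplementing move: player I chooses $j\in\mathbb{N}$ and a choice function $F$ for $\mathcal{A}_m$; the game continues from $(w_m-1,\mathcal{A}_m(F/j),\mathcal{B}_m(\star/j))$. Right supplementing move: player I chooses $j\in\mathbb{N}$ and a choice function $F$ for $\mathcal{B}_m$; the game continues from $(w_m-1,\mathcal{A}_m(\star/j),\mathcal{B}_m(F/j))$. *)

theory Defs
  imports Main
begin

(* A relational vocabulary: the relation symbols are the elements of the domain,
   mapped to their arities.  The vocabulary may be empty or infinite. *)
type_synonym 'r vocabulary = "'r \<rightharpoonup> nat"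

datatype ('r, 'a) model =
  Model (universe: "'a set") (interp: "'r \<Rightarrow> 'a list set")

(* Symbols outside the vocabulary get the empty interpretation, so that a model of the
   vocabulary is uniquely represented. *)
definition is_model :: "'r vocabulary \<Rightarrow> ('r, 'a) model \<Rightarrow> bool" where
  "is_model voc M \<longleftrightarrow> universe M \<noteq> {} \<and>
     (\<forall>r. case voc r of
            None \<Rightarrow> interp M r = {}
          | Some n \<Rightarrow> interp M r \<subseteq> {xs. length xs = n \<and> set xs \<subseteq> universe M})"

type_synonym 'a assignment = "nat \<rightharpoonup> 'a"

definition is_assignment :: "('r, 'a) model \<Rightarrow> 'a assignment \<Rightarrow> bool" where
  "is_assignment M \<alpha> \<longleftrightarrow> finite (dom \<alpha>) \<and> ran \<alpha> \<subseteq> universe M"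

type_synonym ('r, 'a) struct = "('r, 'a) model \<times> 'a assignment"

(* The common domain d is an explicit parameter because an empty class does not
   determine it. *)
definition struct_class ::
    "'r vocabulary \<Rightarrow> nat set \<Rightarrow> ('r, 'a) struct set \<Rightarrow> bool" where
  "struct_class voc d \<A> \<longleftrightarrow> finite d \<and>
     (\<forall>(M, \<alpha>) \<in> \<A>. is_model voc M \<and> is_assignment M \<alpha> \<and> dom \<alpha> = d)"

datatype 'r fm =
    Rel 'r "nat list"
  | Eq nat nat
  | Neg "'r fm"
  | Or "'r fm" "'r fm"
  | And "'r fm" "'r fm"
  | Ex nat "'r fm"
  | All nat "'r fm"

primrec formula_of :: "'r vocabulary \<Rightarrow> 'r fm \<Rightarrow> bool" where
  "formula_of voc (Rel r xs) \<longleftrightarrow> voc r = Some (length xs)"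
| "formula_of voc (Eq i j) \<longleftrightarrow> True"
| "formula_of voc (Neg \<phi>) \<longleftrightarrow> formula_of voc \<phi>"
| "formula_of voc (Or \<phi> \<psi>) \<longleftrightarrow> formula_of voc \<phi> \<and> formula_of voc \<psi>"
| "formula_of voc (And \<phi> \<psi>) \<longleftrightarrow> formula_of voc \<phi> \<and> formula_of voc \<psi>"
| "formula_of voc (Ex j \<phi>) \<longleftrightarrow> formula_of voc \<phi>"
| "formula_of voc (All j \<phi>) \<longleftrightarrow> formula_of voc \<phi>"

primrec free_vars :: "'r fm \<Rightarrow> nat set" where
  "free_vars (Rel r xs) = set xs"
| "free_vars (Eq i j) = {i, j}"
| "free_vars (Neg \<phi>) = free_vars \<phi>"
| "free_vars (Or \<phi> \<psi>) = free_vars \<phi> \<union> free_vars \<psi>"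
| "free_vars (And \<phi> \<psi>) = free_vars \<phi> \<union> free_vars \<psi>"
| "free_vars (Ex j \<phi>) = free_vars \<phi> - {j}"
| "free_vars (All j \<phi>) = free_vars \<phi> - {j}"

primrec is_atomic :: "'r fm \<Rightarrow> bool" where
  "is_atomic (Rel r xs) \<longleftrightarrow> True"
| "is_atomic (Eq i j) \<longleftrightarrow> True"
| "is_atomic (Neg \<phi>) \<longleftrightarrow> False"
| "is_atomic (Or \<phi> \<psi>) \<longleftrightarrow> False"
| "is_atomic (And \<phi> \<psi>) \<longleftrightarrow> False"
| "is_atomic (Ex j \<phi>) \<longleftrightarrow> False"
| "is_atomic (All j \<phi>) \<longleftrightarrow> False"

definition is_literal :: "'r fm \<Rightarrow> bool" where
  "is_literal \<phi> \<longleftrightarrow> is_atomic \<phi> \<or> (\<exists>\<psi>. is_atomic \<psi> \<and> \<phi> = Neg \<psi>)"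

primrec fm_size :: "'r fm \<Rightarrow> nat" where
  "fm_size (Rel r xs) = 1"
| "fm_size (Eq i j) = 1"
| "fm_size (Neg \<phi>) = fm_size \<phi>"
| "fm_size (Or \<phi> \<psi>) = fm_size \<phi> + fm_size \<psi>"
| "fm_size (And \<phi> \<psi>) = fm_size \<phi> + fm_size \<psi>"
| "fm_size (Ex j \<phi>) = fm_size \<phi> + 1"
| "fm_size (All j \<phi>) = fm_size \<phi> + 1"

(* Truth values are meaningful only if the free variables lie in the domain of the
   assignment; this is imposed in satisfies. *)
primrec eval_fm :: "('r, 'a) model \<Rightarrow> 'a assignment \<Rightarrow> 'r fm \<Rightarrow> bool" where
  "eval_fm M \<alpha> (Rel r xs) \<longleftrightarrow> map (\<lambda>x. the (\<alpha> x)) xs \<in> interp M r"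
| "eval_fm M \<alpha> (Eq i j) \<longleftrightarrow> the (\<alpha> i) = the (\<alpha> j)"
| "eval_fm M \<alpha> (Neg \<phi>) \<longleftrightarrow> \<not> eval_fm M \<alpha> \<phi>"
| "eval_fm M \<alpha> (Or \<phi> \<psi>) \<longleftrightarrow> eval_fm M \<alpha> \<phi> \<or> eval_fm M \<alpha> \<psi>"
| "eval_fm M \<alpha> (And \<phi> \<psi>) \<longleftrightarrow> eval_fm M \<alpha> \<phi> \<and> eval_fm M \<alpha> \<psi>"
| "eval_fm M \<alpha> (Ex j \<phi>) \<longleftrightarrow> (\<exists>a \<in> universe M. eval_fm M (\<alpha>(j \<mapsto> a)) \<phi>)"
| "eval_fm M \<alpha> (All j \<phi>) \<longleftrightarrow> (\<forall>a \<in> universe M. eval_fm M (\<alpha>(j \<mapsto> a)) \<phi>)"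

definition satisfies :: "('r, 'a) struct \<Rightarrow> 'r fm \<Rightarrow> bool" where
  "satisfies S \<phi> \<longleftrightarrow> free_vars \<phi> \<subseteq> dom (snd S) \<and> eval_fm (fst S) (snd S) \<phi>"

definition separates ::
    "nat set \<Rightarrow> ('r, 'a) struct set \<Rightarrow> ('r, 'a) struct set \<Rightarrow> 'r fm \<Rightarrow> bool" where
  "separates d \<A> \<B> \<phi> \<longleftrightarrow> free_vars \<phi> \<subseteq> d \<and>
     (\<forall>S \<in> \<A>. satisfies S \<phi>) \<and> (\<forall>S \<in> \<B>. \<not> satisfies S \<phi>)"

definition choice_function ::
    "(('r, 'a) struct \<Rightarrow> 'a) \<Rightarrow> ('r, 'a) struct set \<Rightarrow> bool" where
  "choice_function F \<A> \<longleftrightarrow> (\<forall>(M, \<alpha>) \<in> \<A>. F (M, \<alpha>) \<in> universe M)"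

definition extend_choice ::
    "('r, 'a) struct set \<Rightarrow> (('r, 'a) struct \<Rightarrow> 'a) \<Rightarrow> nat \<Rightarrow> ('r, 'a) struct set" where
  "extend_choice \<A> F j = {(M, \<alpha>(j \<mapsto> F (M, \<alpha>))) | M \<alpha>. (M, \<alpha>) \<in> \<A>}"

definition extend_all :: "('r, 'a) struct set \<Rightarrow> nat \<Rightarrow> ('r, 'a) struct set" where
  "extend_all \<A> j = {(M, \<alpha>(j \<mapsto> a)) | M \<alpha> a. (M, \<alpha>) \<in> \<A> \<and> a \<in> universe M}"

(* (w, d, A, B), where d is the common domain of the assignments in A and B *)
type_synonym ('r, 'a) position =
  "nat \<times> nat set \<times> ('r, 'a) struct set \<times> ('r, 'a) struct set"

datatype ('r, 'a) move =
    LeftSplit nat nat "('r, 'a) struct set" "('r, 'a) struct set"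
  | RightSplit nat nat "('r, 'a) struct set" "('r, 'a) struct set"
  | LeftSupp nat "('r, 'a) struct \<Rightarrow> 'a"
  | RightSupp nat "('r, 'a) struct \<Rightarrow> 'a"

fun legal_move :: "('r, 'a) position \<Rightarrow> ('r, 'a) move \<Rightarrow> bool" where
  "legal_move (w, d, \<A>, \<B>) (LeftSplit u v \<C> \<D>) \<longleftrightarrow>
     u \<ge> 1 \<and> v \<ge> 1 \<and> u + v = w \<and> \<A> = \<C> \<union> \<D>"
| "legal_move (w, d, \<A>, \<B>) (RightSplit u v \<C> \<D>) \<longleftrightarrow>
     u \<ge> 1 \<and> v \<ge> 1 \<and> u + v = w \<and> \<B> = \<C> \<union> \<D>"
| "legal_move (w, d, \<A>, \<B>) (LeftSupp j F) \<longleftrightarrow> choice_function F \<A>"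
| "legal_move (w, d, \<A>, \<B>) (RightSupp j F) \<longleftrightarrow> choice_function F \<B>"

(* The positions from which the game may continue after a move of player I; when there
   are two of them, player II chooses. *)
fun continuations :: "('r, 'a) position \<Rightarrow> ('r, 'a) move \<Rightarrow> ('r, 'a) position set" where
  "continuations (w, d, \<A>, \<B>) (LeftSplit u v \<C> \<D>) = {(u, d, \<C>, \<B>), (v, d, \<D>, \<B>)}"
| "continuations (w, d, \<A>, \<B>) (RightSplit u v \<C> \<D>) = {(u, d, \<A>, \<C>), (v, d, \<A>, \<D>)}"
| "continuations (w, d, \<A>, \<B>) (LeftSupp j F) =
     {(w - 1, insert j d, extend_choice \<A> F j, extend_all \<B> j)}"
| "continuations (w, d, \<A>, \<B>) (RightSupp j F) =
     {(w - 1, insert j d, extend_all \<A> j, extend_choice \<B> F j)}"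

fun won_by_I :: "'r vocabulary \<Rightarrow> ('r, 'a) position \<Rightarrow> bool" where
  "won_by_I voc (w, d, \<A>, \<B>) \<longleftrightarrow>
     (\<exists>\<phi>. formula_of voc \<phi> \<and> is_literal \<phi> \<and> separates d \<A> \<B> \<phi>)"

fun won_by_II :: "'r vocabulary \<Rightarrow> ('r, 'a) position \<Rightarrow> bool" where
  "won_by_II voc (w, d, \<A>, \<B>) \<longleftrightarrow> \<not> won_by_I voc (w, d, \<A>, \<B>) \<and> w = 1"

definition game_over :: "'r vocabulary \<Rightarrow> ('r, 'a) position \<Rightarrow> bool" where
  "game_over voc p \<longleftrightarrow> won_by_I voc p \<or> won_by_II voc p"

(* A strategy of player I gives a move for each nonempty sequence of positions visited so
   far (oldest first). *)
type_synonym ('r, 'a) strategy = "('r, 'a) position list \<Rightarrow> ('r, 'a) move"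

(* The partial plays from p in which player I moves according to \<sigma>. *)
inductive partial_play ::
    "'r vocabulary \<Rightarrow> ('r, 'a) strategy \<Rightarrow> ('r, 'a) position \<Rightarrow> ('r, 'a) position list \<Rightarrow> bool"
  for voc \<sigma> p where
  start: "partial_play voc \<sigma> p [p]"
| step: "partial_play voc \<sigma> p h \<Longrightarrow> \<not> game_over voc (last h) \<Longrightarrow>
    legal_move (last h) (\<sigma> h) \<Longrightarrow> q \<in> continuations (last h) (\<sigma> h) \<Longrightarrow>
    partial_play voc \<sigma> p (h @ [q])"

(* Along every play the first component strictly decreases and stays positive, so there
   are no infinite plays; it suffices that \<sigma> never gets stuck and that every play that
   ends is won by player I. *)
definition winning_strategy_I ::
    "'r vocabulary \<Rightarrow> ('r, 'a) position \<Rightarrow> ('r, 'a) strategy \<Rightarrow> bool" where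
  "winning_strategy_I voc p \<sigma> \<longleftrightarrow>
     (\<forall>h. partial_play voc \<sigma> p h \<longrightarrow>
        (if game_over voc (last h) then won_by_I voc (last h)
         else legal_move (last h) (\<sigma> h)))"

end

theory Submission
  imports Defs
begin

text \<open>
  Call a position separable if some formula of size at most \<open>w\<close> separates its two classes.
  A position in which the game goes on is separable if and only if player I has a legal move
  all of whose continuations are separable: splitting moves correspond to disjunctions and
  conjunctions, supplementing moves to quantifiers, and negation exchanges the two classes,
  so that only the left moves have to be treated. Moving to separable positions is therefore
  a winning strategy. Conversely, since the first component decreases, induction shows that
  every position reached under a winning strategy is separable.
\<close>

section \<open>Separable positions, good moves, and exchanging the two classes\<close>

fun valid_position :: "'r vocabulary \<Rightarrow> ('r, 'a) position \<Rightarrow> bool" where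
  "valid_position voc (w, d, \<A>, \<B>) \<longleftrightarrow> w \<ge> 1 \<and> struct_class voc d \<A> \<and> struct_class voc d \<B>"

fun separable :: "'r vocabulary \<Rightarrow> ('r, 'a) position \<Rightarrow> bool" where
  "separable voc (w, d, \<A>, \<B>) \<longleftrightarrow>
     (\<exists>\<phi>. formula_of voc \<phi> \<and> fm_size \<phi> \<le> w \<and> separates d \<A> \<B> \<phi>)"

definition good_move :: "'r vocabulary \<Rightarrow> ('r, 'a) position \<Rightarrow> ('r, 'a) move \<Rightarrow> bool" where
  "good_move voc p m \<longleftrightarrow> legal_move p m \<and> (\<forall>q \<in> continuations p m. separable voc q)"

fun swap_position :: "('r, 'a) position \<Rightarrow> ('r, 'a) position" where
  "swap_position (w, d, \<A>, \<B>) = (w, d, \<B>, \<A>)"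

fun swap_move :: "('r, 'a) move \<Rightarrow> ('r, 'a) move" where
  "swap_move (LeftSplit u v \<C> \<D>) = RightSplit u v \<C> \<D>"
| "swap_move (RightSplit u v \<C> \<D>) = LeftSplit u v \<C> \<D>"
| "swap_move (LeftSupp j F) = RightSupp j F"
| "swap_move (RightSupp j F) = LeftSupp j F"

lemma swap_position_swap_position [simp]: "swap_position (swap_position p) = p"
  by (cases p) simp

lemma legal_move_swap [simp]: "legal_move (swap_position p) (swap_move m) \<longleftrightarrow> legal_move p m"
proof -
  obtain w d \<A> \<B> where "p = (w, d, \<A>, \<B>)" by (cases p)
  then show ?thesis by (cases m) simp_all
qed

lemma continuations_swap:
  "continuations (swap_position p) (swap_move m) = swap_position ` continuations p m"
proof -
  obtain w d \<A> \<B> where "p = (w, d, \<A>, \<B>)" by (cases p)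
  then show ?thesis by (cases m) simp_all
qed

lemma valid_position_swap [simp]: "valid_position voc (swap_position p) \<longleftrightarrow> valid_position voc p"
  by (cases p) auto

section \<open>Separation in terms of truth values, and invariance of validity under moves\<close>

lemma fm_size_pos: "fm_size \<phi> \<ge> 1"
  by (induction \<phi>) auto

text \<open>All assignments have domain \<open>d\<close>, so the domain clause in
  \<open>satisfies\<close> holds automatically. Without this, both \<phi> and
  \<open>Neg \<phi>\<close> could fail in a structure, and negation would not exchange the
  classes.\<close>

lemma separates_iff_eval:
  assumes "struct_class voc d \<A>" and "struct_class voc d \<B>"
  shows "separates d \<A> \<B> \<phi> \<longleftrightarrow> free_vars \<phi> \<subseteq> d \<and>
    (\<forall>(M, \<alpha>) \<in> \<A>. eval_fm M \<alpha> \<phi>) \<and> (\<forall>(M, \<alpha>) \<in> \<B>. \<not> eval_fm M \<alpha> \<phi>)"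
proof -
  have "satisfies (M, \<alpha>) \<phi> \<longleftrightarrow> eval_fm M \<alpha> \<phi>"
    if "free_vars \<phi> \<subseteq> d" and "(M, \<alpha>) \<in> \<A> \<union> \<B>" for M \<alpha>
  proof -
    have "dom \<alpha> = d" using assms that(2) by (auto simp: struct_class_def)
    with that(1) show ?thesis by (simp add: satisfies_def)
  qed
  then show ?thesis unfolding separates_def by (auto simp: Ball_def)
qed

lemma separates_Neg:
  assumes "struct_class voc d \<A>" and "struct_class voc d \<B>"
  shows "separates d \<A> \<B> (Neg \<phi>) \<longleftrightarrow> separates d \<B> \<A> \<phi>"
  by (auto simp: separates_iff_eval[OF assms] separates_iff_eval[OF assms(2,1)])

lemma is_assignment_upd:
  assumes "is_assignment M \<alpha>" and "a \<in> universe M"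
  shows "is_assignment M (\<alpha>(j \<mapsto> a))"
proof -
  have "ran (\<alpha>(j \<mapsto> a)) \<subseteq> insert a (ran \<alpha>)" by (auto simp: ran_def)
  with assms show ?thesis unfolding is_assignment_def by auto
qed

lemma struct_class_extend_choice:
  "struct_class voc d \<A> \<Longrightarrow> choice_function F \<A> \<Longrightarrow>
    struct_class voc (insert j d) (extend_choice \<A> F j)"
  unfolding struct_class_def extend_choice_def choice_function_def
  by (auto intro!: is_assignment_upd)

lemma struct_class_extend_all:
  "struct_class voc d \<A> \<Longrightarrow> struct_class voc (insert j d) (extend_all \<A> j)"
  unfolding struct_class_def extend_all_def by (auto intro!: is_assignment_upd)

lemma struct_class_Un:
  "struct_class voc d (\<C> \<union> \<D>) \<longleftrightarrow> struct_class voc d \<C> \<and> struct_class voc d \<D>"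
  unfolding struct_class_def by blast

text \<open>If the game goes on then w \<ge> 2, so a supplementing move leaves w - 1 \<ge> 1. In a
  splitting move both parts are positive, hence each is smaller than their sum. The decrease drives
  the later induction along plays.\<close>

lemma continuations_valid:
  assumes "valid_position voc p" and "\<not> game_over voc p"
    and "legal_move p m" and "q \<in> continuations p m"
  shows "valid_position voc q \<and> fst q < fst p"
proof -
  obtain w d \<A> \<B> where p: "p = (w, d, \<A>, \<B>)" by (cases p)
  have "w \<ge> 2" using assms(1,2) by (auto simp: p game_over_def)
  with assms(1,3,4) show ?thesis
    by (cases m) (auto simp: p struct_class_Un struct_class_extend_choice struct_class_extend_all)
qed

text \<open>Negation costs nothing in \<open>fm_size\<close>, so the negated formula respects the
  same bound.\<close>

lemma separable_swap_imp:
  assumes "valid_position voc p" and "separable voc p"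
  shows "separable voc (swap_position p)"
proof -
  obtain w d \<A> \<B> where p: "p = (w, d, \<A>, \<B>)" by (cases p)
  obtain \<phi> where "formula_of voc \<phi>" "fm_size \<phi> \<le> w" "separates d \<A> \<B> \<phi>"
    using assms(2) by (auto simp: p)
  moreover have "separates d \<B> \<A> (Neg \<phi>) \<longleftrightarrow> separates d \<A> \<B> \<phi>"
    using assms(1) separates_Neg[of voc d \<B> \<A> \<phi>] by (simp add: p)
  ultimately show ?thesis by (auto simp: p intro!: exI[of _ "Neg \<phi>"])
qed

section \<open>Formulas of size one and the end of the game\<close>

lemma fm_size_literal: "is_literal \<phi> \<Longrightarrow> fm_size \<phi> = 1"
proof -
  have "is_atomic \<psi> \<Longrightarrow> fm_size \<psi> = 1" for \<psi> :: "'a fm" by (cases \<psi>) auto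
  then show "is_literal \<phi> \<Longrightarrow> fm_size \<phi> = 1" by (auto simp: is_literal_def)
qed

text \<open>\<open>Neg\<close> applied to a negated atom is no literal, so in that case the outer
  negation is stripped instead of a second one being added.\<close>

lemma is_literal_negation:
  assumes "is_literal \<phi>" and "formula_of voc \<phi>"
  shows "\<exists>\<psi>. is_literal \<psi> \<and> formula_of voc \<psi> \<and> free_vars \<psi> = free_vars \<phi> \<and>
    (\<forall>M \<alpha>. eval_fm M \<alpha> \<psi> \<longleftrightarrow> \<not> eval_fm M \<alpha> \<phi>)"
proof (cases "is_atomic \<phi>")
  case True
  with assms show ?thesis by (intro exI[of _ "Neg \<phi>"]) (auto simp: is_literal_def)
next
  case False
  then obtain \<chi> where "is_atomic \<chi>" "\<phi> = Neg \<chi>"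
    using assms(1) by (auto simp: is_literal_def)
  with assms show ?thesis by (intro exI[of _ \<chi>]) (auto simp: is_literal_def)
qed

text \<open>Size one leaves only a stack of negations over an atom, since every other constructor
  gives at least 2. Each \<open>Neg\<close> is absorbed by passing to the opposite literal.\<close>

lemma fm_size_1_literal:
  "formula_of voc \<phi> \<Longrightarrow> fm_size \<phi> \<le> 1 \<Longrightarrow>
    \<exists>\<psi>. is_literal \<psi> \<and> formula_of voc \<psi> \<and> free_vars \<psi> = free_vars \<phi> \<and>
      (\<forall>M \<alpha>. eval_fm M \<alpha> \<psi> \<longleftrightarrow> eval_fm M \<alpha> \<phi>)"
proof (induction \<phi>)
  case (Rel r xs)
  then show ?case by (intro exI[of _ "Rel r xs"]) (simp add: is_literal_def)
next
  case (Eq i j)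
  then show ?case by (intro exI[of _ "Eq i j"]) (simp add: is_literal_def)
next
  case (Neg \<phi>)
  then obtain \<psi> where \<psi>: "is_literal \<psi>" "formula_of voc \<psi>" "free_vars \<psi> = free_vars \<phi>"
    "\<And>M :: ('a, 'b) model. \<And>\<alpha>. eval_fm M \<alpha> \<psi> \<longleftrightarrow> eval_fm M \<alpha> \<phi>" by auto
  from is_literal_negation[OF \<psi>(1,2)] \<psi>(3,4) show ?case by (metis eval_fm.simps(3) free_vars.simps(3))
next
  case (Or \<phi> \<psi>)
  with fm_size_pos[of \<phi>] fm_size_pos[of \<psi>] show ?case by simp
next
  case (And \<phi> \<psi>)
  with fm_size_pos[of \<phi>] fm_size_pos[of \<psi>] show ?case by simp
next
  case (Ex j \<phi>)
  with fm_size_pos[of \<phi>] show ?case by simp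
next
  case (All j \<phi>)
  with fm_size_pos[of \<phi>] show ?case by simp
qed

lemma won_by_I_of_size_1:
  assumes "formula_of voc \<phi>" and "fm_size \<phi> \<le> 1" and "separates d \<A> \<B> \<phi>"
  shows "won_by_I voc (w, d, \<A>, \<B>)"
proof -
  obtain \<psi> where \<psi>: "is_literal \<psi>" "formula_of voc \<psi>" "free_vars \<psi> = free_vars \<phi>"
    "\<And>M :: ('a, 'b) model. \<And>\<alpha>. eval_fm M \<alpha> \<psi> \<longleftrightarrow> eval_fm M \<alpha> \<phi>"
    using fm_size_1_literal[OF assms(1,2)] by blast
  then have "separates d \<A> \<B> \<psi>"
    using assms(3) by (simp add: separates_def satisfies_def)
  with \<psi> show ?thesis by auto
qed

text \<open>A win of player II requires w = 1 and no separating literal, but a separating formula of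
  size at most 1 can be replaced by a literal.\<close>

lemma game_over_separable:
  assumes "game_over voc p" and "separable voc p"
  shows "won_by_I voc p"
proof (cases p)
  case (fields w d \<A> \<B>)
  with assms won_by_I_of_size_1[of voc _ d \<A> \<B> w] show ?thesis
    unfolding game_over_def fields separable.simps won_by_II.simps by blast
qed

lemma won_by_I_separable:
  assumes "valid_position voc p" and "won_by_I voc p"
  shows "separable voc p"
proof -
  obtain w d \<A> \<B> where p: "p = (w, d, \<A>, \<B>)" by (cases p)
  obtain \<phi> where \<phi>: "formula_of voc \<phi>" "is_literal \<phi>" "separates d \<A> \<B> \<phi>"
    using assms(2) by (auto simp: p)
  then have "formula_of voc \<phi> \<and> fm_size \<phi> \<le> w \<and> separates d \<A> \<B> \<phi>"
    using assms(1) fm_size_literal[OF \<phi>(2)] by (simp add: p)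
  then show ?thesis unfolding p separable.simps ..
qed

lemma game_over_swap:
  assumes "valid_position voc p"
  shows "game_over voc (swap_position p) \<longleftrightarrow> game_over voc p"
proof -
  have *: "won_by_I voc (swap_position q)" if valid: "valid_position voc q" and won: "won_by_I voc q"
    for q :: "('a, 'b) position"
  proof -
    obtain w d \<A> \<B> where q: "q = (w, d, \<A>, \<B>)" by (cases q)
    obtain \<phi> where \<phi>: "formula_of voc \<phi>" "is_literal \<phi>" "separates d \<A> \<B> \<phi>"
      using won by (auto simp: q)
    \<comment> \<open>\<open>Neg \<phi>\<close> may be a double negation and so not a literal; its
      size suffices to obtain one.\<close>
    have "fm_size (Neg \<phi>) \<le> 1" using fm_size_literal[OF \<phi>(2)] by simp
    moreover have "separates d \<B> \<A> (Neg \<phi>)"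
      using \<phi>(3) valid separates_Neg[of voc d \<B> \<A>] by (simp add: q)
    ultimately show ?thesis
      using \<phi>(1) won_by_I_of_size_1[of voc "Neg \<phi>"] by (simp add: q del: won_by_I.simps)
  qed
  have "won_by_I voc (swap_position p) \<longleftrightarrow> won_by_I voc p"
    using *[of p] *[of "swap_position p"] assms by auto
  then show ?thesis by (cases p) (auto simp: game_over_def simp del: won_by_I.simps)
qed

text \<open>The swap of a separable position is known to be separable only for valid positions; the
  continuations are valid because the game is not over.\<close>

lemma good_move_swap:
  assumes "valid_position voc p" and "\<not> game_over voc p" and "good_move voc p m"
  shows "good_move voc (swap_position p) (swap_move m)"
proof -
  have "separable voc (swap_position q)" if "q \<in> continuations p m" for q
    using assms that continuations_valid[of voc p m q] separable_swap_imp[of voc q]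
    by (simp add: good_move_def)
  with assms(3) show ?thesis by (simp add: good_move_def continuations_swap)
qed

section \<open>From a separating formula to a good move\<close>

lemma good_move_of_Or:
  assumes "struct_class voc d \<A>" and "struct_class voc d \<B>"
    and "formula_of voc (Or \<phi> \<psi>)" and "fm_size (Or \<phi> \<psi>) \<le> w"
    and "separates d \<A> \<B> (Or \<phi> \<psi>)"
  shows "\<exists>m. good_move voc (w, d, \<A>, \<B>) m"
proof -
  \<comment> \<open>The parts may overlap; a legal splitting only asks for their union.\<close>
  define \<C> where "\<C> = {(M, \<alpha>) \<in> \<A>. eval_fm M \<alpha> \<phi>}"
  define \<D> where "\<D> = {(M, \<alpha>) \<in> \<A>. eval_fm M \<alpha> \<psi>}"
  have sep: "free_vars (Or \<phi> \<psi>) \<subseteq> d" "\<forall>(M, \<alpha>) \<in> \<A>. eval_fm M \<alpha> (Or \<phi> \<psi>)"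
    "\<forall>(M, \<alpha>) \<in> \<B>. \<not> eval_fm M \<alpha> (Or \<phi> \<psi>)"
    using assms(5) unfolding separates_iff_eval[OF assms(1,2)] by blast+
  have \<A>: "\<A> = \<C> \<union> \<D>" using sep(2) by (auto simp: \<C>_def \<D>_def)
  then have \<C>\<D>: "struct_class voc d \<C>" "struct_class voc d \<D>"
    using assms(1) by (simp_all add: struct_class_Un)
  have "separates d \<C> \<B> \<phi>"
    unfolding separates_iff_eval[OF \<C>\<D>(1) assms(2)] using sep by (auto simp: \<C>_def)
  moreover have "separates d \<D> \<B> \<psi>"
    unfolding separates_iff_eval[OF \<C>\<D>(2) assms(2)] using sep by (auto simp: \<D>_def)
  moreover have "fm_size \<phi> \<ge> 1" "fm_size \<psi> \<ge> 1" by (rule fm_size_pos)+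
  \<comment> \<open>The two numbers must add up to exactly \<open>w\<close>, so the slack in the
    size bound goes to the second part, which still gets at least
    \<open>fm_size \<psi>\<close>.\<close>
  ultimately have "good_move voc (w, d, \<A>, \<B>) (LeftSplit (fm_size \<phi>) (w - fm_size \<phi>) \<C> \<D>)"
    using assms(3,4) \<A> by (auto simp: good_move_def)
  then show ?thesis ..
qed

text \<open>\<open>F\<close> picks a witness of the existential formula in each structure of \<A>,
  while in \<B> every element fails to be one, which is why \<B> is extended by all elements.
  Outside \<A> the values of \<open>F\<close> are arbitrary.\<close>

lemma good_move_of_Ex:
  assumes "struct_class voc d \<A>" and "struct_class voc d \<B>"
    and "formula_of voc (Ex j \<phi>)" and "fm_size (Ex j \<phi>) \<le> w"
    and "separates d \<A> \<B> (Ex j \<phi>)"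
  shows "\<exists>m. good_move voc (w, d, \<A>, \<B>) m"
proof -
  have sep: "free_vars (Ex j \<phi>) \<subseteq> d" "\<forall>(M, \<alpha>) \<in> \<A>. eval_fm M \<alpha> (Ex j \<phi>)"
    "\<forall>(M, \<alpha>) \<in> \<B>. \<not> eval_fm M \<alpha> (Ex j \<phi>)"
    using assms(5) unfolding separates_iff_eval[OF assms(1,2)] by blast+
  define F where "F S = (SOME a. a \<in> universe (fst S) \<and> eval_fm (fst S) ((snd S)(j \<mapsto> a)) \<phi>)"
    for S :: "('a, 'b) struct"
  have F: "F (M, \<alpha>) \<in> universe M \<and> eval_fm M (\<alpha>(j \<mapsto> F (M, \<alpha>))) \<phi>" if "(M, \<alpha>) \<in> \<A>" for M \<alpha>
  proof -
    have "\<exists>a. a \<in> universe M \<and> eval_fm M (\<alpha>(j \<mapsto> a)) \<phi>" using sep(2) that by auto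
    then show ?thesis unfolding F_def fst_conv snd_conv by (rule someI_ex)
  qed
  then have choice: "choice_function F \<A>" by (auto simp: choice_function_def)
  have "separates (insert j d) (extend_choice \<A> F j) (extend_all \<B> j) \<phi>"
    unfolding separates_iff_eval[OF struct_class_extend_choice[OF assms(1) choice]
        struct_class_extend_all[OF assms(2)]]
    using sep F by (auto simp: extend_choice_def extend_all_def)
  then have "good_move voc (w, d, \<A>, \<B>) (LeftSupp j F)"
    using assms(3,4) choice by (auto simp: good_move_def)
  then show ?thesis ..
qed

lemma swap_good_move:
  assumes "valid_position voc (w, d, \<A>, \<B>)" and "\<not> game_over voc (w, d, \<A>, \<B>)"
    and "\<exists>m. good_move voc (w, d, \<B>, \<A>) m"
  shows "\<exists>m. good_move voc (w, d, \<A>, \<B>) m"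
proof -
  obtain m where "good_move voc (w, d, \<B>, \<A>) m" using assms(3) ..
  moreover have "valid_position voc (w, d, \<B>, \<A>)" using assms(1) by simp
  moreover have "\<not> game_over voc (w, d, \<B>, \<A>)"
    using assms(2) game_over_swap[OF assms(1)] by (simp only: swap_position.simps not_False_eq_True)
  ultimately have "good_move voc (swap_position (w, d, \<B>, \<A>)) (swap_move m)"
    by (intro good_move_swap)
  then show ?thesis unfolding swap_position.simps ..
qed

text \<open>The outermost connective other than \<open>Neg\<close> dictates the move, so the
  induction hypothesis is used only to peel off negations; as these exchange the classes, \<A> and
  \<B> are generalized. An atom would already have ended the game.\<close>

lemma good_move_of_separates:
  assumes "valid_position voc (w, d, \<A>, \<B>)" and "\<not> game_over voc (w, d, \<A>, \<B>)"
    and "formula_of voc \<phi>" and "fm_size \<phi> \<le> w" and "separates d \<A> \<B> \<phi>"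
  shows "\<exists>m. good_move voc (w, d, \<A>, \<B>) m"
  using assms
proof (induction \<phi> arbitrary: \<A> \<B>)
  case (Rel r xs)
  have "fm_size (Rel r xs) \<le> 1" by simp
  with Rel.prems won_by_I_of_size_1 show ?case unfolding game_over_def by blast
next
  case (Eq i j)
  have "fm_size (Eq i j) \<le> 1" by simp
  with Eq.prems won_by_I_of_size_1 show ?case unfolding game_over_def by blast
next
  case (Neg \<phi>)
  have "separates d \<B> \<A> \<phi>"
    using Neg.prems(1,5) separates_Neg[of voc d \<A> \<B> \<phi>] by simp
  moreover have "\<not> game_over voc (w, d, \<B>, \<A>)"
    using Neg.prems(2) game_over_swap[OF Neg.prems(1)] by (simp only: swap_position.simps not_False_eq_True)
  ultimately have "\<exists>m. good_move voc (w, d, \<B>, \<A>) m"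
    using Neg.IH[of \<B> \<A>] Neg.prems by simp
  with Neg.prems(1,2) show ?case by (rule swap_good_move)
next
  case (Or \<phi> \<psi>)
  then show ?case by (intro good_move_of_Or[of voc d \<A> \<B> \<phi> \<psi>]) simp_all
next
  case (And \<phi> \<psi>)
  have cls: "struct_class voc d \<A>" "struct_class voc d \<B>" using And.prems(1) by simp_all
  \<comment> \<open>De Morgan: the dual disjunction has the same size as the conjunction.\<close>
  have "separates d \<B> \<A> (Or (Neg \<phi>) (Neg \<psi>))"
    using And.prems(5)
    unfolding separates_iff_eval[OF cls] separates_iff_eval[OF cls(2,1)] by auto
  then have "\<exists>m. good_move voc (w, d, \<B>, \<A>) m"
    using And.prems cls by (intro good_move_of_Or[of voc d \<B> \<A> "Neg \<phi>" "Neg \<psi>"]) simp_all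
  with And.prems(1,2) show ?case by (rule swap_good_move)
next
  case (Ex j \<phi>)
  then show ?case by (intro good_move_of_Ex[of voc d \<A> \<B> j \<phi>]) simp_all
next
  case (All j \<phi>)
  have cls: "struct_class voc d \<A>" "struct_class voc d \<B>" using All.prems(1) by simp_all
  \<comment> \<open>The dual existential formula again has the same size.\<close>
  have "separates d \<B> \<A> (Ex j (Neg \<phi>))"
    using All.prems(5)
    unfolding separates_iff_eval[OF cls] separates_iff_eval[OF cls(2,1)] by auto
  then have "\<exists>m. good_move voc (w, d, \<B>, \<A>) m"
    using All.prems cls by (intro good_move_of_Ex[of voc d \<B> \<A> j "Neg \<phi>"]) simp_all
  with All.prems(1,2) show ?case by (rule swap_good_move)
qed

section \<open>From a good move to a separating formula\<close>

lemma separable_of_left_move: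
  assumes "valid_position voc p" and "\<not> game_over voc p" and "good_move voc p m"
    and "m = LeftSplit u v \<C> \<D> \<or> m = LeftSupp j F"
  shows "separable voc p"
proof -
  obtain w d \<A> \<B> where p: "p = (w, d, \<A>, \<B>)" by (cases p)
  have cls: "w \<ge> 2" "struct_class voc d \<A>" "struct_class voc d \<B>"
    using assms(1,2) by (auto simp: p game_over_def)
  from assms(4) show ?thesis
  proof
    assume m: "m = LeftSplit u v \<C> \<D>"
    obtain \<phi> \<psi> where \<phi>: "formula_of voc \<phi>" "fm_size \<phi> \<le> u" "separates d \<C> \<B> \<phi>"
      and \<psi>: "formula_of voc \<psi>" "fm_size \<psi> \<le> v" "separates d \<D> \<B> \<psi>"
      and uv: "u + v = w" "\<A> = \<C> \<union> \<D>"
      using assms(3) by (auto simp: p m good_move_def)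
    have \<C>\<D>: "struct_class voc d \<C>" "struct_class voc d \<D>"
      using cls(2) uv(2) by (simp_all add: struct_class_Un)
    have "separates d \<A> \<B> (Or \<phi> \<psi>)"
      using \<phi>(3) \<psi>(3)
      unfolding separates_iff_eval[OF cls(2,3)] separates_iff_eval[OF \<C>\<D>(1) cls(3)]
        separates_iff_eval[OF \<C>\<D>(2) cls(3)]
      by (auto simp: uv(2))
    with \<phi> \<psi> uv show ?thesis by (auto simp: p intro!: exI[of _ "Or \<phi> \<psi>"])
  next
    assume m: "m = LeftSupp j F"
    obtain \<phi> where \<phi>: "formula_of voc \<phi>" "fm_size \<phi> \<le> w - 1"
        "separates (insert j d) (extend_choice \<A> F j) (extend_all \<B> j) \<phi>"
      and choice: "choice_function F \<A>"
      using assms(3) by (auto simp: p m good_move_def)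
    have ext: "free_vars \<phi> \<subseteq> insert j d"
      "\<forall>(M, \<alpha>) \<in> extend_choice \<A> F j. eval_fm M \<alpha> \<phi>"
      "\<forall>(M, \<alpha>) \<in> extend_all \<B> j. \<not> eval_fm M \<alpha> \<phi>"
      using \<phi>(3)
      unfolding separates_iff_eval[OF struct_class_extend_choice[OF cls(2) choice]
          struct_class_extend_all[OF cls(3)]]
      by blast+
    have "eval_fm M \<alpha> (Ex j \<phi>)" if "(M, \<alpha>) \<in> \<A>" for M \<alpha>
    proof -
      have "F (M, \<alpha>) \<in> universe M" using choice that by (auto simp: choice_function_def)
      moreover have "eval_fm M (\<alpha>(j \<mapsto> F (M, \<alpha>))) \<phi>"
        using ext(2) that by (auto simp: extend_choice_def)
      ultimately show ?thesis by auto
    qed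
    moreover have "\<not> eval_fm M \<alpha> (Ex j \<phi>)" if "(M, \<alpha>) \<in> \<B>" for M \<alpha>
      using ext(3) that by (auto simp: extend_all_def)
    \<comment> \<open>Removing \<open>j\<close> brings the free variables back into
      \<open>d\<close>, whether or not \<open>j\<close> was already in \<open>d\<close>.\<close>
    moreover have "free_vars (Ex j \<phi>) \<subseteq> d" using ext(1) by auto
    ultimately have "separates d \<A> \<B> (Ex j \<phi>)"
      unfolding separates_iff_eval[OF cls(2,3)] by blast
    \<comment> \<open>Since w \<ge> 2, the subtraction in \<open>w - 1\<close> is not truncated, and
      the quantifier uses up the unit spent on the move.\<close>
    with \<phi> cls(1) show ?thesis by (auto simp: p intro!: exI[of _ "Ex j \<phi>"])
  qed
qed

text \<open>A right move becomes a left move in the swapped position; the formula found there is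
  carried back by negation.\<close>

lemma separable_of_good_move:
  assumes "valid_position voc p" and "\<not> game_over voc p" and "good_move voc p m"
  shows "separable voc p"
proof -
  have swapped: "separable voc p"
    if "swap_move m = LeftSplit u v \<C> \<D> \<or> swap_move m = LeftSupp j F" for u v \<C> \<D> j F
  proof -
    have "separable voc (swap_position p)"
      using separable_of_left_move[OF _ _ good_move_swap[OF assms] that] assms(1,2)
      by (simp add: game_over_swap)
    with separable_swap_imp[of voc "swap_position p"] assms(1) show ?thesis by simp
  qed
  show ?thesis
    using separable_of_left_move[OF assms] swapped by (cases m) simp_all
qed

section \<open>Winning strategies and separability\<close>

lemma separable_of_winning_strategy:
  assumes "valid_position voc p" and "winning_strategy_I voc p \<sigma>"
  shows "separable voc p"
proof -
  \<comment> \<open>The claim is about histories, not positions, because \<sigma> may depend on the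
    whole play so far.\<close>
  have "partial_play voc \<sigma> p h \<Longrightarrow> valid_position voc (last h) \<Longrightarrow> separable voc (last h)" for h
  proof (induction "fst (last h)" arbitrary: h rule: less_induct)
    case less
    have win: "if game_over voc (last h) then won_by_I voc (last h) else legal_move (last h) (\<sigma> h)"
      using assms(2) less.prems(1) unfolding winning_strategy_I_def by blast
    show ?case
    proof (cases "game_over voc (last h)")
      case True
      with win less.prems(2) show ?thesis by (simp add: won_by_I_separable)
    next
      case False
      with win have legal: "legal_move (last h) (\<sigma> h)" by simp
      have "separable voc q" if q: "q \<in> continuations (last h) (\<sigma> h)" for q
      proof -
        have "partial_play voc \<sigma> p (h @ [q])"
          using less.prems(1) False legal q by (rule partial_play.step)
        with less.hyps[of "h @ [q]"] continuations_valid[OF less.prems(2) False legal q]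
        show ?thesis by simp
      qed
      with legal have "good_move voc (last h) (\<sigma> h)" by (simp add: good_move_def)
      with separable_of_good_move less.prems(2) False show ?thesis by blast
    qed
  qed
  from this[of "[p]"] assms(1) show ?thesis by (simp add: partial_play.start)
qed

lemma winning_strategy_of_separable:
  assumes "valid_position voc p" and "separable voc p"
  shows "\<exists>\<sigma>. winning_strategy_I voc p \<sigma>"
proof -
  \<comment> \<open>This strategy looks only at the current position; where no good move exists its
    value is arbitrary.\<close>
  define \<sigma> where "\<sigma> h = (SOME m. good_move voc (last h) m)" for h :: "('a, 'b) position list"
  have good: "good_move voc (last h) (\<sigma> h)"
    if "valid_position voc (last h)" "separable voc (last h)" "\<not> game_over voc (last h)" for h
  proof -
    have "\<exists>m. good_move voc (last h) m"
      using that good_move_of_separates by (cases "last h") (simp only: separable.simps, blast)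
    then show ?thesis unfolding \<sigma>_def by (rule someI_ex)
  qed
  \<comment> \<open>Separability is preserved whichever continuation player II picks, since a good
    move makes all of them separable.\<close>
  have inv: "partial_play voc \<sigma> p h \<Longrightarrow> valid_position voc (last h) \<and> separable voc (last h)" for h
  proof (induction rule: partial_play.induct)
    case start
    with assms show ?case by simp
  next
    case (step h q)
    with good[of h] continuations_valid[of voc "last h" "\<sigma> h" q] show ?case
      by (simp add: good_move_def)
  qed
  have "winning_strategy_I voc p \<sigma>"
    unfolding winning_strategy_I_def
  proof (intro allI impI)
    fix h assume "partial_play voc \<sigma> p h"
    \<comment> \<open>A finished play ends in a separable position, which excludes a win of player
      II; in an unfinished one the good move is legal.\<close>
    from inv[OF this] good[of h] game_over_separable[of voc "last h"]
    show "if game_over voc (last h) then won_by_I voc (last h) else legal_move (last h) (\<sigma> h)"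
      by (simp add: good_move_def)
  qed
  then show ?thesis by blast
qed

theorem theorem10:
  fixes voc :: "'r vocabulary"
    and d :: "nat set"
    and \<A> \<B> :: "('r, 'a) struct set"
    and w :: nat
  assumes "struct_class voc d \<A>"
    and "struct_class voc d \<B>"
    and "w \<ge> 1"
  shows "(\<exists>\<sigma>. winning_strategy_I voc (w, d, \<A>, \<B>) \<sigma>) \<longleftrightarrow>
         (\<exists>\<phi>. formula_of voc \<phi> \<and> fm_size \<phi> \<le> w \<and> separates d \<A> \<B> \<phi>)"
proof -
  have "valid_position voc (w, d, \<A>, \<B>)" using assms by simp
  with separable_of_winning_strategy winning_strategy_of_separable
  show ?thesis unfolding separable.simps[symmetric] by blast
qed

end
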